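(* Let $G$ be a plane graph with maximum degree $\Delta\ge 1$. Then $\pi_{fl}(G)\le 5\Delta$. Moreover, there is a function $g:\mathbb{Z}_+\to\mathbb{Z}_+$ with $g(\Delta)=(2+o(1))\Delta$ (i.e. $g(\Delta)/\Delta\to 2$ as $\Delta\to\infty$) such that $\pi_{fl}(G)\le g(\Delta)$ for every plane graph $G$ of maximum degree $\Delta$.
   Context: All graphs are simple and finite. A sequence $r_1r_2\dots r_{2n}$ ($n\ge1$) is a repetition if $r_i=r_{n+i}$ for all $i=1,\dots,n$. In a plane graph $G$, a facial path is a path of $G$ whose vertices and edges are consecutive on the boundary walk of some face (of any component) of $G$. A vertex colouring $\varphi$ of $G$ is facial non-repetitive if for no facial path $v_1v_2\dots v_{2n}$ ($n\ge1$) the sequence $\varphi(v_1)\varphi(v_2)\dots\varphi(v_{2n})$ is a repetition. $G$ is facial non-repetitively $l$-choosable if for every assignment $L$ of lists $L(v)\subseteq\mathbb{Z}_+$ with $|L(v)|\ge l$ for all vertices $v$ there is a facial non-repetitive colouring $\varphi$ with $\varphi(v)\in L(v)$ for all $v$. The facial Thue choice number $\pi_{fl}(G)$ is the minimum $l$ such that $G$ is facial non-repetitively $l$-choosable. *)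

theory Defs
  imports "HOL-Analysis.Analysis"
begin

section \<open>Plane graphs\<close>

text \<open>
  Vertices are points of the plane, identified with the complex numbers. An edge is the
  two-element set of its ends, which makes the graph simple; the edge with ends \<open>u\<close> and \<open>v\<close>
  is drawn as the arc \<open>curve G u v\<close>, running from \<open>u\<close> to \<open>v\<close>. The values of \<open>curve G u v\<close>
  for non-adjacent \<open>u\<close>, \<open>v\<close> are irrelevant.
\<close>

record drawn_graph =
  verts :: "complex set"
  edges :: "complex set set"
  curve :: "complex \<Rightarrow> complex \<Rightarrow> real \<Rightarrow> complex"

definition plane_graph :: "drawn_graph \<Rightarrow> bool" where
  "plane_graph G \<longleftrightarrow>
     finite (verts G) \<and>
     (\<forall>e\<in>edges G. e \<subseteq> verts G \<and> card e = 2) \<and>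
     (\<forall>u v. {u, v} \<in> edges G \<longrightarrow>
        arc (curve G u v) \<and> pathstart (curve G u v) = u \<and> pathfinish (curve G u v) = v \<and>
        curve G v u = reversepath (curve G u v) \<and>
        path_image (curve G u v) \<inter> verts G = {u, v}) \<and>
     (\<forall>u v x y. {u, v} \<in> edges G \<and> {x, y} \<in> edges G \<and> {u, v} \<noteq> {x, y} \<longrightarrow>
        path_image (curve G u v) \<inter> path_image (curve G x y) \<subseteq> {u, v} \<inter> {x, y})"

definition nbrs :: "drawn_graph \<Rightarrow> complex \<Rightarrow> complex set" where
  "nbrs G v = {u. {v, u} \<in> edges G}"

definition degree :: "drawn_graph \<Rightarrow> complex \<Rightarrow> nat" where
  "degree G v = card (nbrs G v)"

definition max_degree :: "drawn_graph \<Rightarrow> nat" where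
  "max_degree G = (SUP v\<in>verts G. degree G v)"

definition graph_components :: "drawn_graph \<Rightarrow> complex set set" where
  "graph_components G = {{y. (\<lambda>u v. {u, v} \<in> edges G)\<^sup>*\<^sup>* x y} | x. x \<in> verts G}"


section \<open>Faces and their boundary walks\<close>

definition drawing :: "drawn_graph \<Rightarrow> complex set \<Rightarrow> complex set" where
  "drawing G C = C \<union> \<Union>{path_image (curve G u v) | u v. u \<in> C \<and> v \<in> C \<and> {u, v} \<in> edges G}"

definition faces :: "drawn_graph \<Rightarrow> complex set \<Rightarrow> complex set set" where
  "faces G C = components (- drawing G C)"

text \<open>
  The rotation at a vertex \<open>v\<close>, for arbitrary (possibly spiralling) arcs. Each edge \<open>vu\<close>,
  traversed from \<open>v\<close>, has a first point on the circle of radius \<open>r\<close> around \<open>v\<close>, provided \<open>r\<close> is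
  small. The cyclic order of these points on the circle does not depend on \<open>r\<close>, as the initial
  pieces of the edges are disjoint arcs from the centre of the disc to its boundary; it is the
  cyclic order of the edges around \<open>v\<close>.
\<close>

definition exit_point :: "drawn_graph \<Rightarrow> complex \<Rightarrow> real \<Rightarrow> complex \<Rightarrow> complex" where
  "exit_point G v r u = curve G v u (Inf {t \<in> {0..1}. dist v (curve G v u t) = r})"

definition ccw_angle :: "drawn_graph \<Rightarrow> complex \<Rightarrow> real \<Rightarrow> complex \<Rightarrow> complex \<Rightarrow> real" where
  "ccw_angle G v r u w = Arg2pi ((exit_point G v r w - v) / (exit_point G v r u - v))"

text \<open>
  \<open>ccw_next G v u w\<close>: the edge \<open>vw\<close> is the one following \<open>vu\<close> in the counterclockwise order
  around \<open>v\<close>. At a vertex of degree one the only edge follows itself.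
\<close>

definition ccw_next :: "drawn_graph \<Rightarrow> complex \<Rightarrow> complex \<Rightarrow> complex \<Rightarrow> bool" where
  "ccw_next G v u w \<longleftrightarrow> u \<in> nbrs G v \<and> w \<in> nbrs G v \<and>
     (if nbrs G v = {u} then w = u
      else w \<noteq> u \<and> (\<forall>\<^sub>F r in at_right 0. \<forall>x \<in> nbrs G v - {u}. ccw_angle G v r u w \<le> ccw_angle G v r u x))"

text \<open>
  The boundary walk of a face \<open>F\<close> of the component with vertex set \<open>C\<close>, as the cyclic list of its
  vertices: having come to a vertex along an edge, it leaves along the next edge in the rotation,
  so that the face stays on its right, and it closes up once it is about to repeat a step. It
  covers exactly the frontier of \<open>F\<close>. (Distinct faces of a connected plane graph have the same
  frontier only if the graph is a cycle, and then their boundary walks are the reverse of each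
  other.) The trivial walk around an isolated vertex is left out, since no path with an even
  number of vertices lies on it.
\<close>

definition boundary_walk ::
    "drawn_graph \<Rightarrow> complex set \<Rightarrow> complex set \<Rightarrow> complex list \<Rightarrow> bool" where
  "boundary_walk G C F ws \<longleftrightarrow>
     (let m = length ws; w = (\<lambda>i. ws ! (i mod m)) in
        ws \<noteq> [] \<and> set ws \<subseteq> C \<and>
        (\<forall>i<m. ccw_next G (w (i + 1)) (w i) (w (i + 2))) \<and>
        inj_on (\<lambda>i. (w i, w (i + 1))) {..<m} \<and>
        (\<Union>i<m. path_image (curve G (w i) (w (i + 1)))) = frontier F)"

definition consecutive_on :: "'a list \<Rightarrow> 'a list \<Rightarrow> bool" where
  "consecutive_on ws p \<longleftrightarrow> (\<exists>s. \<forall>i<length p. p ! i = ws ! ((s + i) mod length ws))"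

text \<open>
  A path is given by the list of its vertices. As the graph is simple, its edges are consecutive
  on a walk as soon as its vertices are. Paths may be read in either direction.
\<close>

definition facial_path :: "drawn_graph \<Rightarrow> complex list \<Rightarrow> bool" where
  "facial_path G p \<longleftrightarrow> p \<noteq> [] \<and> distinct p \<and>
     (\<exists>C\<in>graph_components G. \<exists>F\<in>faces G C. \<exists>ws. boundary_walk G C F ws \<and>
        (consecutive_on ws p \<or> consecutive_on ws (rev p)))"


section \<open>Facial non-repetitive colourings\<close>

definition repetition :: "'a list \<Rightarrow> bool" where
  "repetition rs \<longleftrightarrow> (\<exists>n\<ge>1. length rs = 2 * n \<and> (\<forall>i<n. rs ! i = rs ! (n + i)))"

definition facial_nonrepetitive :: "drawn_graph \<Rightarrow> (complex \<Rightarrow> nat) \<Rightarrow> bool" where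
  "facial_nonrepetitive G \<phi> \<longleftrightarrow> (\<forall>p. facial_path G p \<longrightarrow> \<not> repetition (map \<phi> p))"

text \<open>Lists may be infinite, in which case \<open>card\<close> would return \<open>0\<close>.\<close>

definition facial_nonrep_choosable :: "drawn_graph \<Rightarrow> nat \<Rightarrow> bool" where
  "facial_nonrep_choosable G l \<longleftrightarrow>
     (\<forall>L :: complex \<Rightarrow> nat set.
        (\<forall>v\<in>verts G. L v \<subseteq> {1..} \<and> (finite (L v) \<longrightarrow> l \<le> card (L v))) \<longrightarrow>
        (\<exists>\<phi>. (\<forall>v\<in>verts G. \<phi> v \<in> L v) \<and> facial_nonrepetitive G \<phi>))"

definition facial_thue_choice_number :: "drawn_graph \<Rightarrow> nat" where
  "facial_thue_choice_number G = (LEAST l. facial_nonrep_choosable G l)"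

end

theory Submission imports Defs begin

text \<open>
  A facial walk is determined by any one of its steps, so at most \<open>2n\<Delta>\<close> facial paths with \<open>2n\<close>
  vertices pass through a given vertex, and at most \<open>\<Delta>\<close> if \<open>n = 1\<close> and orientation is ignored.
  The rest is Rosenfeld's counting argument. Let \<open>\<Phi> S\<close> be the set of valid list colourings of
  \<open>S\<close>; one shows \<open>|\<Phi> (S \<union> {v})| \<ge> \<beta> |\<Phi> S|\<close> by induction on \<open>S\<close>. An extension to \<open>v\<close> of a valid
  colouring fails only if it is a repetition on some path through \<open>v\<close>; given a path with \<open>2n\<close>
  vertices it is then determined by its values outside the half containing \<open>v\<close>, so by induction
  there are at most \<open>|\<Phi> S| / \<beta>^(n-1)\<close> such extensions. With lists of size \<open>l\<close> it suffices that
  \<open>\<beta> + \<Delta> (1 + \<Sum>n\<ge>2. 2n / \<beta>^(n-1)) \<le> l\<close>. The choice \<open>\<beta> = 2\<Delta>\<close> gives \<open>l = 5\<Delta>\<close> for \<open>\<Delta> \<ge> 2\<close>, and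
  \<open>\<beta> = \<Delta>/2\<close> gives \<open>l = 2\<Delta>\<close> for \<open>\<Delta> \<ge> 20\<close>.
\<close>

section \<open>Non-repetitive list colourings by counting\<close>

lemma repetition_rev:
  assumes "repetition xs" shows "repetition (rev xs)"
proof -
  obtain n where n: "n \<ge> 1" "length xs = 2 * n" "\<And>i. i < n \<Longrightarrow> xs ! i = xs ! (n + i)"
    using assms unfolding repetition_def by blast
  have "rev xs ! i = rev xs ! (n + i)" if "i < n" for i
  proof -
    have e: "2 * n - Suc i = n + (n - Suc i)" "2 * n - Suc (n + i) = n - Suc i" using that by auto
    show ?thesis using that n(2) n(3)[of "n - Suc i"] by (simp add: rev_nth e)
  qed
  then show ?thesis using n unfolding repetition_def by (intro exI[of _ n]) simp
qed

text \<open>\<open>PiE\<close> fixes the value outside \<open>S\<close>, so a colouring is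
  determined by its values on \<open>S\<close> and counting makes sense.\<close>

definition nonrep_colourings :: "'a list set \<Rightarrow> ('a \<Rightarrow> 'b set) \<Rightarrow> 'a set \<Rightarrow> ('a \<Rightarrow> 'b) set" where
  "nonrep_colourings P L S =
     {c \<in> PiE S L. \<forall>p\<in>P. set p \<subseteq> S \<longrightarrow> \<not> repetition (map c p)}"

lemma finite_nonrep_colourings:
  assumes "finite S" "\<And>v. v \<in> S \<Longrightarrow> finite (L v)"
  shows "finite (nonrep_colourings P L S)"
  using finite_PiE[OF assms] unfolding nonrep_colourings_def by (rule finite_subset[rotated]) auto

lemma nonrep_colourings_restrict:
  assumes "c \<in> nonrep_colourings P L S" "T \<subseteq> S"
  shows "restrict c T \<in> nonrep_colourings P L T"
proof -
  have c: "c \<in> PiE S L" "\<And>p. p \<in> P \<Longrightarrow> set p \<subseteq> S \<Longrightarrow> \<not> repetition (map c p)"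
    using assms(1) by (auto simp: nonrep_colourings_def)
  have "restrict c T \<in> PiE T L" using c(1) assms(2) by (auto simp: PiE_iff)
  moreover have "\<not> repetition (map (restrict c T) p)" if "p \<in> P" "set p \<subseteq> T" for p
  proof -
    have "map (restrict c T) p = map c p" using that by auto
    then show ?thesis using c(2)[of p] that assms(2) by (simp only: subset_trans) auto
  qed
  ultimately show ?thesis by (simp add: nonrep_colourings_def)
qed

text \<open>\<open>H\<close> is the half of \<open>p\<close> containing \<open>v\<close>, and
  \<open>f\<close> sends an entry to the one at the same position of the other half. As
  \<open>f\<close> does not depend on \<open>c\<close>, the colours on \<open>H\<close> can be
  recovered from those outside \<open>H\<close> whenever \<open>c\<close> is repetitive on
  \<open>p\<close>.\<close>

lemma repetition_half:
  assumes "distinct p" "length p = 2 * n" "v \<in> set p"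
  obtains H f where "H \<subseteq> set p" "v \<in> H" "card H = n" "\<And>h. h \<in> H \<Longrightarrow> f h \<in> set p - H"
    "\<And>c h. repetition (map c p) \<Longrightarrow> h \<in> H \<Longrightarrow> c h = c (f h)"
proof -
  have rep: "c (p ! i) = c (p ! (n + i))" if "repetition (map c p)" "i < n" for c i
    using that assms(2) unfolding repetition_def by auto
  define A where "A = (\<lambda>i. p ! i) ` {..<n}"
  define B where "B = (\<lambda>i. p ! (n + i)) ` {..<n}"
  have AB: "A \<subseteq> set p" "B \<subseteq> set p" "A \<inter> B = {}"
    using assms(1,2) by (auto simp: A_def B_def nth_eq_iff_index_eq)
  have iA: "inj_on (\<lambda>i. p ! i) {..<n}" and iB: "inj_on (\<lambda>i. p ! (n + i)) {..<n}"
    using assms(1,2) by (auto simp: inj_on_def nth_eq_iff_index_eq)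
  have card: "card A = n" "card B = n" unfolding A_def B_def using iA iB by (simp_all add: card_image)
  obtain k where k: "k < 2 * n" "p ! k = v" using assms(2,3) by (metis in_set_conv_nth)
  show thesis
  proof (cases "k < n")
    case True
    define f where "f h = p ! (n + the_inv_into {..<n} (\<lambda>i. p ! i) h)" for h
    have f: "f (p ! i) = p ! (n + i)" if "i < n" for i
      using the_inv_into_f_f[OF iA] that by (simp add: f_def)
    show thesis
    proof (rule that[of A f])
      show "v \<in> A" using True k by (auto simp: A_def)
      show "f h \<in> set p - A" if "h \<in> A" for h
      proof -
        have "f h \<in> B" using that f by (auto simp: A_def B_def)
        then show ?thesis using AB by auto
      qed
    qed (use AB card rep f in \<open>auto simp: A_def\<close>)
  next
    case False
    define f where "f h = p ! (the_inv_into {..<n} (\<lambda>i. p ! (n + i)) h)" for h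
    have f: "f (p ! (n + i)) = p ! i" if "i < n" for i
      using the_inv_into_f_f[OF iB] that by (simp add: f_def)
    show thesis
    proof (rule that[of B f])
      show "v \<in> B" using False k unfolding B_def by (intro image_eqI[of _ _ "k - n"]) auto
      show "f h \<in> set p - B" if "h \<in> B" for h
      proof -
        have "f h \<in> A" using that f by (auto simp: A_def B_def)
        then show ?thesis using AB by auto
      qed
    qed (use AB card rep[symmetric] f in \<open>auto simp: B_def\<close>)
  qed
qed

text \<open>
  The set \<open>Q v m\<close> accounts for the lists with \<open>2m + 2\<close> entries through \<open>v\<close>, one of each pair of
  mutually reverse lists being enough.
\<close>

locale nonrep_counting =
  fixes V :: "'a set" and P :: "'a list set" and Q :: "'a \<Rightarrow> nat \<Rightarrow> 'a list set"
    and a :: "nat \<Rightarrow> real" and L :: "'a \<Rightarrow> 'b set" and l :: nat and \<beta> :: real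
  assumes fin: "finite V"
    and L: "\<And>v. v \<in> V \<Longrightarrow> finite (L v)" "\<And>v. v \<in> V \<Longrightarrow> card (L v) = l"
    and distinct: "\<And>p. p \<in> P \<Longrightarrow> distinct p"
    and finQ: "\<And>v m. v \<in> V \<Longrightarrow> finite (Q v m)"
    and cardQ: "\<And>v m. v \<in> V \<Longrightarrow> real (card (Q v m)) \<le> a m"
    and Q: "\<And>v m p. p \<in> Q v m \<Longrightarrow> distinct p \<and> length p = 2 * Suc m \<and> v \<in> set p"
    and cover: "\<And>v m p. p \<in> P \<Longrightarrow> v \<in> set p \<Longrightarrow> length p = 2 * Suc m \<Longrightarrow>
                  p \<in> Q v m \<or> rev p \<in> Q v m"
    and \<beta>: "\<beta> > 0" "\<And>N. \<beta> + (\<Sum>m<N. a m / \<beta> ^ m) \<le> l"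
begin

abbreviation (input) \<Phi> where "\<Phi> \<equiv> nonrep_colourings P L"

abbreviation (input) "extensions S v \<equiv> {c \<in> PiE (insert v S) L. restrict c S \<in> \<Phi> S}"

text \<open>An extension amounts to a free choice from the list of \<open>v\<close> together with a
  valid colouring of \<open>S\<close>.\<close>

lemma card_extensions:
  assumes "v \<in> V" "S \<subseteq> V" "v \<notin> S"
  shows "finite (extensions S v)" "card (extensions S v) = l * card (\<Phi> S)"
proof -
  have finS: "finite (insert v S)" using fin assms finite_subset by auto
  have "finite (PiE (insert v S) L)" using finS L(1) assms by (intro finite_PiE) auto
  then show "finite (extensions S v)" by simp
  have "bij_betw (\<lambda>(x, c). c(v := x)) (L v \<times> \<Phi> S) (extensions S v)"
  proof (rule bij_betw_byWitness[where f' = "\<lambda>c. (c v, restrict c S)"])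
    show "\<forall>z\<in>L v \<times> \<Phi> S. ((case z of (x, c) \<Rightarrow> c(v := x)) v,
        restrict (case z of (x, c) \<Rightarrow> c(v := x)) S) = z"
      using assms by (auto simp: nonrep_colourings_def PiE_def extensional_def fun_eq_iff)
    show "\<forall>c\<in>extensions S v. (case (c v, restrict c S) of (x, c) \<Rightarrow> c(v := x)) = c"
      by (auto simp: PiE_def extensional_def fun_eq_iff)
    show "(\<lambda>(x, c). c(v := x)) ` (L v \<times> \<Phi> S) \<subseteq> extensions S v"
    proof clarsimp
      fix x c assume x: "x \<in> L v" and c: "c \<in> \<Phi> S"
      have "c \<in> PiE S L" using c by (simp add: nonrep_colourings_def)
      moreover from this have "restrict (c(v := x)) S = c"
        using assms(3) by (auto simp: PiE_def extensional_def fun_eq_iff)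
      ultimately show "c(v := x) \<in> PiE (insert v S) L \<and> restrict (c(v := x)) S \<in> \<Phi> S"
        using x c by (auto simp: PiE_def extensional_def Pi_def)
    qed
    show "(\<lambda>c. (c v, restrict c S)) ` extensions S v \<subseteq> L v \<times> \<Phi> S" by auto
  qed
  from bij_betw_same_card[OF this] show "card (extensions S v) = l * card (\<Phi> S)"
    using L(2)[OF assms(1)] by (simp add: card_cartesian_product)
qed

lemma card_insert_ge:
  "v \<in> V \<Longrightarrow> S \<subseteq> V \<Longrightarrow> v \<notin> S \<Longrightarrow> \<beta> * card (\<Phi> S) \<le> card (\<Phi> (insert v S))"
proof (induction "card S" arbitrary: S v rule: less_induct)
  case less
  have finV: "finite S" using less.prems fin finite_subset by auto
  have finPhi: "finite (\<Phi> T)" if "T \<subseteq> V" for T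
    using that fin L finite_subset by (intro finite_nonrep_colourings) auto
  \<comment> \<open>The elements of \<open>D\<close> are put back one at a time. Each set that
    receives one is smaller than \<open>S\<close>, so the induction hypothesis yields a factor
    \<open>\<beta>\<close> every time.\<close>
  have mono: "\<beta> ^ card D * card (\<Phi> (S - D)) \<le> card (\<Phi> S)" if "D \<subseteq> S" for D
    using finite_subset[OF that finV] that
  proof (induction D rule: finite_induct)
    case (insert d D)
    let ?T = "S - insert d D"
    have "\<beta> * card (\<Phi> ?T) \<le> card (\<Phi> (insert d ?T))"
    proof (rule less.hyps)
      show "card ?T < card S" using insert finV by (intro psubset_card_mono) auto
    qed (use insert less.prems in auto)
    also have "insert d ?T = S - D" using insert by auto
    finally have "\<beta> ^ card D * (\<beta> * card (\<Phi> ?T)) \<le> \<beta> ^ card D * card (\<Phi> (S - D))"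
      using \<beta>(1) by (intro mult_left_mono) auto
    then show ?case using insert by (simp add: mult.assoc mult.left_commute)
  qed simp
  \<comment> \<open>A list of \<open>2m + 2\<close> distinct vertices exists only if
    \<open>m < card V\<close>, so this bounds the sums over \<open>m\<close>.\<close>
  let ?N = "card V"
  define Qs where "Qs m = {p \<in> Q v m. set p \<subseteq> insert v S}" for m
  define B where "B p = {c \<in> extensions S v. repetition (map c p)}" for p
  have finB: "finite (B p)" for p
    by (rule finite_subset[OF _ card_extensions(1)[OF less.prems]]) (auto simp: B_def)
  \<comment> \<open>Forgetting the colours on \<open>H\<close> loses nothing, since the repetition
    restores them, and leaves a valid colouring of \<open>T\<close>.\<close>
  have bad: "card (B p) \<le> card (\<Phi> S) / \<beta> ^ m" if p: "p \<in> Qs m" for p m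
  proof -
    have "distinct p" "length p = 2 * Suc m" "v \<in> set p" using p Q unfolding Qs_def by blast+
    then obtain H f where H: "H \<subseteq> set p" "v \<in> H" "card H = Suc m"
      and f: "\<And>h. h \<in> H \<Longrightarrow> f h \<in> set p - H"
      and rep: "\<And>(c :: 'a \<Rightarrow> 'b) h. repetition (map c p) \<Longrightarrow> h \<in> H \<Longrightarrow> c h = c (f h)"
      by (rule repetition_half) blast
    have pS: "set p \<subseteq> insert v S" using p by (simp add: Qs_def)
    define T where "T = S - H"
    have T: "T \<subseteq> S" by (auto simp: T_def)
    have "inj_on (\<lambda>c. restrict c T) (B p)"
    proof (rule inj_onI)
      fix c c' assume c: "c \<in> B p" "c' \<in> B p" and eq: "restrict c T = restrict c' T"
      have eqT: "c x = c' x" if "x \<in> T" for x using eq that by (metis restrict_apply')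
      have "c x = c' x" if "x \<in> insert v S" for x
      proof (cases "x \<in> H")
        case True
        then have "f x \<in> T" using f H pS unfolding T_def by blast
        then show ?thesis using rep[of c x] rep[of c' x] c True eqT unfolding B_def by auto
      next
        case False
        then show ?thesis using that eqT H unfolding T_def by auto
      qed
      moreover have "c \<in> PiE (insert v S) L" "c' \<in> PiE (insert v S) L" using c by (auto simp: B_def)
      ultimately show "c = c'" by (intro PiE_ext) auto
    qed
    moreover have "(\<lambda>c. restrict c T) ` B p \<subseteq> \<Phi> T"
    proof
      fix g assume "g \<in> (\<lambda>c. restrict c T) ` B p"
      then obtain c where c: "c \<in> B p" "g = restrict c T" by auto
      have "restrict (restrict c S) T = restrict c T" using T by (simp add: Int_absorb1)
      then show "g \<in> \<Phi> T" using nonrep_colourings_restrict[of "restrict c S" P L S T] T c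
        by (auto simp: B_def)
    qed
    ultimately have le: "card (B p) \<le> card (\<Phi> T)"
      using finPhi T less.prems by (intro card_inj_on_le) auto
    \<comment> \<open>Of the \<open>m + 1\<close> vertices of \<open>H\<close>, the vertex
      \<open>v\<close> is not in \<open>S\<close>; hence the exponent \<open>m\<close>.\<close>
    have "T = S - (H - {v})" using less.prems by (auto simp: T_def)
    moreover have "card (H - {v}) = m" using H by simp
    ultimately have "\<beta> ^ m * card (\<Phi> T) \<le> card (\<Phi> S)"
      using mono[of "H - {v}"] H pS by auto
    then have "card (\<Phi> T) \<le> card (\<Phi> S) / \<beta> ^ m"
      using \<beta>(1) by (simp add: field_simps)
    with le show ?thesis by linarith
  qed
  \<comment> \<open>A repetition on a list avoiding \<open>v\<close> would already occur in the
    restriction to \<open>S\<close>, so every new one runs through \<open>v\<close>. As reversal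
    preserves repetitions, having \<open>p\<close> or \<open>rev p\<close> in \<open>Qs m\<close>
    suffices.\<close>
  have sub: "extensions S v \<subseteq> \<Phi> (insert v S) \<union> (\<Union>m<?N. \<Union>p\<in>Qs m. B p)"
  proof
    fix c assume c: "c \<in> extensions S v"
    show "c \<in> \<Phi> (insert v S) \<union> (\<Union>m<?N. \<Union>p\<in>Qs m. B p)"
    proof (cases "c \<in> \<Phi> (insert v S)")
      case False
      then obtain p where p: "p \<in> P" "set p \<subseteq> insert v S" "repetition (map c p)"
        using c unfolding nonrep_colourings_def by auto
      have "v \<in> set p"
      proof (rule ccontr)
        assume "v \<notin> set p"
        then have "set p \<subseteq> S" using p by auto
        then have eq: "map (restrict c S) p = map c p" by auto
        have "\<not> repetition (map (restrict c S) p)"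
          using c p(1) \<open>set p \<subseteq> S\<close> unfolding nonrep_colourings_def by blast
        then show False using p(3) unfolding eq by blast
      qed
      obtain n where n: "n \<ge> 1" "length p = 2 * n" using p(3) by (auto simp: repetition_def)
      then obtain m where m: "n = Suc m" by (cases n) auto
      have "length p = card (set p)" using distinct[OF p(1)] by (simp add: distinct_card)
      also have "\<dots> \<le> ?N" using p(2) less.prems fin by (intro card_mono) auto
      finally have "m < ?N" using n m by simp
      moreover have "c \<in> B p" "c \<in> B (rev p)"
        using c p(3) repetition_rev[of "map c p"] by (simp_all add: B_def rev_map)
      moreover have "p \<in> Qs m \<or> rev p \<in> Qs m"
        using cover[OF p(1) \<open>v \<in> set p\<close>, of m] n m p(2) by (auto simp: Qs_def)
      ultimately show ?thesis by blast
    qed simp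
  qed
  have finQs: "finite (Qs m)" for m using finQ[OF less.prems(1)] by (simp add: Qs_def)
  have "real (l * card (\<Phi> S)) \<le> card (\<Phi> (insert v S) \<union> (\<Union>m<?N. \<Union>p\<in>Qs m. B p))"
    using card_mono[OF _ sub] finB finQs finPhi[of "insert v S"] less.prems
    by (simp add: card_extensions(2)[OF less.prems] del: of_nat_mult)
  also have "\<dots> \<le> real (card (\<Phi> (insert v S))) + real (card (\<Union>m<?N. \<Union>p\<in>Qs m. B p))"
    using card_Un_le by (metis of_nat_le_iff of_nat_add)
  also have "real (card (\<Union>m<?N. \<Union>p\<in>Qs m. B p)) \<le> (\<Sum>m<?N. \<Sum>p\<in>Qs m. real (card (B p)))"
  proof -
    have "card (\<Union>m<?N. \<Union>p\<in>Qs m. B p) \<le> (\<Sum>m<?N. card (\<Union>p\<in>Qs m. B p))"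
      by (intro card_UN_le) auto
    also have "\<dots> \<le> (\<Sum>m<?N. \<Sum>p\<in>Qs m. card (B p))"
      using finQs by (intro sum_mono card_UN_le) auto
    finally show ?thesis by (metis (mono_tags, lifting) of_nat_le_iff of_nat_sum sum.cong)
  qed
  also have "(\<Sum>m<?N. \<Sum>p\<in>Qs m. real (card (B p))) \<le> (\<Sum>m<?N. a m / \<beta> ^ m * card (\<Phi> S))"
  proof (rule sum_mono)
    fix m
    have "(\<Sum>p\<in>Qs m. real (card (B p))) \<le> card (Qs m) * (card (\<Phi> S) / \<beta> ^ m)"
      using bad by (intro sum_bounded_above) auto
    also have "\<dots> \<le> a m * (card (\<Phi> S) / \<beta> ^ m)"
    proof (rule mult_right_mono)
      have "card (Qs m) \<le> card (Q v m)"
        using finQ[OF less.prems(1)] by (intro card_mono) (auto simp: Qs_def)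
      then show "card (Qs m) \<le> a m" using cardQ[OF less.prems(1), of m] by linarith
    qed (use \<beta>(1) in auto)
    finally show "(\<Sum>p\<in>Qs m. real (card (B p))) \<le> a m / \<beta> ^ m * card (\<Phi> S)" by simp
  qed
  also have "\<dots> = (\<Sum>m<?N. a m / \<beta> ^ m) * card (\<Phi> S)" by (simp add: sum_distrib_right)
  \<comment> \<open>The condition linking \<open>\<beta>\<close> and \<open>l\<close> enters here:
    of the \<open>l * card (\<Phi> S)\<close> extensions, at least
    \<open>\<beta> * card (\<Phi> S)\<close> survive.\<close>
  also have "\<dots> \<le> (l - \<beta>) * card (\<Phi> S)"
    using \<beta>(2)[of ?N] by (intro mult_right_mono) auto
  finally show ?case by (simp add: algebra_simps)
qed

text \<open>The empty set has exactly one colouring, and each added vertex multiplies the number by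
  at least \<open>\<beta> > 0\<close>, so it never drops to zero.\<close>

theorem nonrep_colouring_exists:
  obtains c where "\<And>v. v \<in> V \<Longrightarrow> c v \<in> L v"
    "\<And>p. p \<in> P \<Longrightarrow> set p \<subseteq> V \<Longrightarrow> \<not> repetition (map c p)"
proof -
  have "card (\<Phi> S) > 0" if "S \<subseteq> V" for S
    using finite_subset[OF that fin] that
  proof (induction S rule: finite_induct)
    case empty
    have "\<Phi> {} = {\<lambda>x. undefined}" by (auto simp: nonrep_colourings_def repetition_def)
    then show ?case by simp
  next
    case (insert v S)
    then have "0 < \<beta> * card (\<Phi> S)" using \<beta>(1) by simp
    then show ?case using card_insert_ge[of v S] insert by auto
  qed
  then have "\<Phi> V \<noteq> {}" by fastforce
  then show thesis using that unfolding nonrep_colourings_def by (auto simp: PiE_iff)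
qed

end

section \<open>Facial walks are determined by a single step\<close>

lemma plane_graph_edge:
  assumes "plane_graph G" "{u, v} \<in> edges G"
  shows "u \<noteq> v" "u \<in> verts G" "v \<in> verts G"
  using assms unfolding plane_graph_def by fastforce+

text \<open>Along the arc the distance from \<open>v\<close> goes continuously from 0 to more than
  \<open>r\<close>, so the times at distance \<open>r\<close> form a nonempty closed set and the
  infimum is attained.\<close>

lemma exit_point:
  assumes "plane_graph G" "{v, u} \<in> edges G" "0 < r" "r < dist v u"
  shows "dist v (exit_point G v r u) = r" "exit_point G v r u \<in> path_image (curve G v u)"
proof -
  let ?c = "curve G v u"
  define T where "T = {t \<in> {0..1}. dist v (?c t) = r}"
  have c: "arc ?c" "pathstart ?c = v" "pathfinish ?c = u"
    using assms(1,2) unfolding plane_graph_def by blast+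
  have cont: "continuous_on {0..1} (\<lambda>t. dist v (?c t))"
    using c(1) by (intro continuous_intros) (simp add: arc_def path_def)
  have "\<exists>t\<ge>0. t \<le> 1 \<and> dist v (?c t) = r"
    by (rule IVT') (use c assms cont in \<open>auto simp: pathstart_def pathfinish_def\<close>)
  then have "T \<noteq> {}" by (auto simp: T_def)
  moreover have "closed T" unfolding T_def
    by (rule continuous_closed_preimage_constant[OF cont]) simp
  moreover have "bdd_below T" by (auto simp: T_def intro: bdd_belowI[of _ 0])
  ultimately have "Inf T \<in> T" by (intro closed_contains_Inf)
  then show "dist v (exit_point G v r u) = r" "exit_point G v r u \<in> path_image ?c"
    unfolding exit_point_def T_def by (auto simp: path_image_def)
qed

text \<open>Two successors have equal angles for all small \<open>r\<close>, so their exit points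
  coincide; but distinct edges at \<open>v\<close> meet only in \<open>v\<close>.\<close>

lemma ccw_next_unique:
  assumes G: "plane_graph G" and w: "ccw_next G v u w" and w': "ccw_next G v u w'"
  shows "w = w'"
proof (rule ccontr)
  assume ne: "w \<noteq> w'"
  let ?e = "exit_point G v"
  have N: "nbrs G v \<noteq> {u}" using w w' ne by (auto simp: ccw_next_def split: if_splits)
  have ed: "{v, u} \<in> edges G" "{v, w} \<in> edges G" "{v, w'} \<in> edges G"
    using w w' by (auto simp: ccw_next_def nbrs_def)
  have pos: "dist v u > 0" "dist v w > 0" "dist v w' > 0" using ed plane_graph_edge[OF G] by auto
  \<comment> \<open>For \<open>r\<close> below the distances to the three neighbours, the exit
    points really lie on the circle of radius \<open>r\<close>.\<close>
  have ev: "\<forall>\<^sub>F r in at_right 0. r > 0 \<and> r < x" if "x > 0" for x :: real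
    using eventually_at_right_real[OF that] by eventually_elim simp
  have "\<forall>\<^sub>F r in at_right 0. ccw_angle G v r u w = ccw_angle G v r u w' \<and>
      0 < r \<and> r < dist v u \<and> r < dist v w \<and> r < dist v w'"
  proof -
    have mem: "w \<in> nbrs G v - {u}" "w' \<in> nbrs G v - {u}" using w w' N by (auto simp: ccw_next_def)
    have "\<forall>\<^sub>F r in at_right 0. \<forall>x \<in> nbrs G v - {u}. ccw_angle G v r u w \<le> ccw_angle G v r u x"
      "\<forall>\<^sub>F r in at_right 0. \<forall>x \<in> nbrs G v - {u}. ccw_angle G v r u w' \<le> ccw_angle G v r u x"
      using w w' N by (auto simp: ccw_next_def)
    then show ?thesis
      using ev[OF pos(1)] ev[OF pos(2)] ev[OF pos(3)]
      by eventually_elim (use mem in \<open>blast intro: antisym\<close>)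
  qed
  then obtain r where r: "ccw_angle G v r u w = ccw_angle G v r u w'" "0 < r" "r < dist v u"
    "r < dist v w" "r < dist v w'"
    using eventually_happens'[OF trivial_limit_at_right_real] by blast
  note e = exit_point[OF G ed(1) r(2,3)] exit_point[OF G ed(2) r(2,4)] exit_point[OF G ed(3) r(2,5)]
  have n: "norm (?e r u - v) = r" "norm (?e r w - v) = r" "norm (?e r w' - v) = r"
    using e by (auto simp: dist_norm norm_minus_commute)
  have "norm ((?e r w - v) / (?e r u - v)) = norm ((?e r w' - v) / (?e r u - v))"
    by (simp add: norm_divide n)
  then have "(?e r w - v) / (?e r u - v) = (?e r w' - v) / (?e r u - v)"
    using r(1) unfolding ccw_angle_def by (metis Arg2pi_eq)
  moreover have "?e r u - v \<noteq> 0" using n(1) r(2) by auto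
  ultimately have eq: "?e r w = ?e r w'" by simp
  have "{v, w} \<noteq> {v, w'}" using ne by (auto simp: doubleton_eq_iff)
  then have "path_image (curve G v w) \<inter> path_image (curve G v w') \<subseteq> {v, w} \<inter> {v, w'}"
    using G ed unfolding plane_graph_def by blast
  then have "?e r w \<in> {v, w} \<inter> {v, w'}" using e eq by auto
  then have "?e r w = v" using ne by auto
  then show False using n r by auto
qed

definition cyc :: "'a list \<Rightarrow> nat \<Rightarrow> 'a" where
  "cyc ws i = ws ! (i mod length ws)"

text \<open>This isolates the rotation rule of a boundary walk, on all indices of the periodic
  sequence \<open>cyc ws\<close>, so that walks can be compared without reducing indices.\<close>

definition rotation_walk :: "drawn_graph \<Rightarrow> complex list \<Rightarrow> bool" where
  "rotation_walk G ws \<longleftrightarrow> ws \<noteq> [] \<and> (\<forall>i. ccw_next G (cyc ws (i + 1)) (cyc ws i) (cyc ws (i + 2)))"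

lemma cyc_add_mult: "cyc ws (i + length ws * k) = cyc ws i"
  by (simp add: cyc_def)

lemma rotation_walk_if_boundary_walk:
  assumes "boundary_walk G C F ws" shows "rotation_walk G ws"
proof -
  have ne: "ws \<noteq> []" using assms by (simp add: boundary_walk_def Let_def)
  have "ccw_next G (cyc ws (i + 1)) (cyc ws i) (cyc ws (i + 2))" for i
  proof -
    have "\<forall>i<length ws. ccw_next G (cyc ws (i + 1)) (cyc ws i) (cyc ws (i + 2))"
      using assms by (simp add: boundary_walk_def Let_def cyc_def)
    from this[rule_format, of "i mod length ws"] ne show ?thesis by (simp add: cyc_def mod_simps)
  qed
  then show ?thesis using ne by (simp add: rotation_walk_def)
qed

lemma rotation_walk_adj:
  assumes "rotation_walk G ws"
  shows "cyc ws i \<in> nbrs G (cyc ws (Suc i))" "cyc ws (Suc i) \<in> nbrs G (cyc ws i)"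
  using assms unfolding rotation_walk_def ccw_next_def nbrs_def by (auto simp: insert_commute)

lemma rotation_walk_forward:
  assumes G: "plane_graph G" and W: "rotation_walk G ws" "rotation_walk G ws'"
    and eq: "cyc ws i = cyc ws' j" "cyc ws (Suc i) = cyc ws' (Suc j)"
  shows "cyc ws (i + k) = cyc ws' (j + k) \<and> cyc ws (Suc (i + k)) = cyc ws' (Suc (j + k))"
proof (induction k)
  case (Suc k)
  have "ccw_next G (cyc ws (Suc (i + k))) (cyc ws (i + k)) (cyc ws (Suc (Suc (i + k))))"
    "ccw_next G (cyc ws' (Suc (j + k))) (cyc ws' (j + k)) (cyc ws' (Suc (Suc (j + k))))"
    using W unfolding rotation_walk_def by simp_all
  then show ?case using Suc ccw_next_unique[OF G] by simp
qed (use eq in simp)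

text \<open>Walks also agree before a common step, since going back amounts to going around.\<close>

lemma rotation_walk_determined:
  assumes G: "plane_graph G" and W: "rotation_walk G ws" "rotation_walk G ws'"
    and eq: "cyc ws (s + j) = cyc ws' (s' + j)" "cyc ws (Suc (s + j)) = cyc ws' (Suc (s' + j))"
  shows "cyc ws (s + k) = cyc ws' (s' + k)"
proof -
  \<comment> \<open>\<open>M\<close> is a multiple of both periods, and \<open>M \<ge> j\<close>
    keeps the subtraction \<open>k + M - j\<close> from truncating.\<close>
  define M where "M = length ws * length ws' * j"
  have "length ws * length ws' \<ge> 1" using W by (simp add: rotation_walk_def Suc_le_eq)
  then have M: "M \<ge> j" by (simp add: M_def)
  have "cyc ws (s + k) = cyc ws (s + k + M)"
    using cyc_add_mult[of ws "s + k" "length ws' * j"] by (simp add: M_def mult.assoc)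
  also have "\<dots> = cyc ws (s + j + (k + M - j))" using M by (simp add: add.assoc)
  also have "\<dots> = cyc ws' (s' + j + (k + M - j))" using rotation_walk_forward[OF G W eq] by blast
  also have "\<dots> = cyc ws' (s' + k + M)" using M by (simp add: add.assoc)
  also have "\<dots> = cyc ws' (s' + k)"
    using cyc_add_mult[of ws' "s' + k" "length ws * j"] by (simp add: M_def ac_simps)
  finally show ?thesis .
qed

text \<open>Only the direction of the walk is allowed here; facial paths are recovered up to
  reversal.\<close>

definition walk_paths :: "drawn_graph \<Rightarrow> complex list set" where
  "walk_paths G = {p. distinct p \<and>
     (\<exists>ws s. rotation_walk G ws \<and> (\<forall>i<length p. p ! i = cyc ws (s + i)))}"

lemma facial_path_walk_paths:
  assumes "facial_path G p"
  shows "p \<in> walk_paths G \<or> rev p \<in> walk_paths G"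
proof -
  obtain C F ws where ws: "boundary_walk G C F ws" "consecutive_on ws p \<or> consecutive_on ws (rev p)"
    and p: "distinct p" using assms unfolding facial_path_def by blast
  have "q \<in> walk_paths G" if "consecutive_on ws q" "distinct q" for q
    using that rotation_walk_if_boundary_walk[OF ws(1)]
    unfolding walk_paths_def consecutive_on_def cyc_def by blast
  then show ?thesis using ws(2) p by auto
qed

lemma walk_paths_adj:
  assumes "p \<in> walk_paths G" "Suc i < length p"
  shows "p ! Suc i \<in> nbrs G (p ! i)" "p ! i \<in> nbrs G (p ! Suc i)"
  using assms rotation_walk_adj unfolding walk_paths_def by force+

lemma facial_path_verts:
  assumes "plane_graph G" "facial_path G p"
  shows "set p \<subseteq> verts G"
proof -
  obtain C F ws where C: "C \<in> graph_components G" "boundary_walk G C F ws"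
    "consecutive_on ws p \<or> consecutive_on ws (rev p)"
    using assms(2) unfolding facial_path_def by blast
  have ws: "ws \<noteq> []" "set ws \<subseteq> C" using C(2) by (simp_all add: boundary_walk_def Let_def)
  have sub: "set q \<subseteq> set ws" if "consecutive_on ws q" for q
    using that ws(1) unfolding consecutive_on_def by (auto simp: in_set_conv_nth[of _ q])
  have "set p \<subseteq> set ws" using C(3) sub[of p] sub[of "rev p"] by auto
  moreover have "C \<subseteq> verts G"
  proof
    fix y assume "y \<in> C"
    then obtain x where x: "x \<in> verts G" "(\<lambda>u v. {u, v} \<in> edges G)\<^sup>*\<^sup>* x y"
      using C(1) unfolding graph_components_def by auto
    show "y \<in> verts G"
      using x(2,1) by (induction rule: rtranclp_induct) (auto dest: plane_graph_edge[OF assms(1)])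
  qed
  ultimately show ?thesis using ws by auto
qed

section \<open>Counting paths through a vertex\<close>

lemma finite_nbrs:
  assumes "plane_graph G" shows "finite (nbrs G v)"
proof (rule finite_subset)
  show "nbrs G v \<subseteq> verts G" using plane_graph_edge[OF assms] by (auto simp: nbrs_def)
  show "finite (verts G)" using assms by (simp add: plane_graph_def)
qed

lemma card_nbrs_le:
  assumes "plane_graph G" "v \<in> verts G" shows "card (nbrs G v) \<le> max_degree G"
proof -
  have "finite (verts G)" using assms by (simp add: plane_graph_def)
  then have "degree G v \<le> max_degree G"
    unfolding max_degree_def using assms(2) by (intro cSUP_upper) auto
  then show ?thesis by (simp add: degree_def)
qed

text \<open>Such a path is determined by the position \<open>j\<close> of \<open>v\<close> on it,
  with \<open>n\<close> choices, and the vertex \<open>u\<close> following \<open>v\<close> on the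
  walk, with at most \<open>max_degree G\<close> choices.\<close>

lemma card_walk_paths_through:
  assumes G: "plane_graph G" and v: "v \<in> verts G"
  shows "finite {p \<in> walk_paths G. length p = n \<and> v \<in> set p}"
    and "card {p \<in> walk_paths G. length p = n \<and> v \<in> set p} \<le> n * max_degree G"
proof -
  let ?Q = "{p \<in> walk_paths G. length p = n \<and> v \<in> set p}"
  define R where "R p j u \<longleftrightarrow> length p = n \<and> (\<exists>ws s. rotation_walk G ws \<and>
    (\<forall>i<n. p ! i = cyc ws (s + i)) \<and> cyc ws (s + j) = v \<and> cyc ws (Suc (s + j)) = u)" for p j u
  have uniq: "p = q" if "R p j u" "R q j u" for p q j u
  proof -
    obtain ws s where 1: "rotation_walk G ws" "\<And>i. i < n \<Longrightarrow> p ! i = cyc ws (s + i)"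
      "cyc ws (s + j) = v" "cyc ws (Suc (s + j)) = u" using \<open>R p j u\<close> unfolding R_def by blast
    obtain ws' s' where 2: "rotation_walk G ws'" "\<And>i. i < n \<Longrightarrow> q ! i = cyc ws' (s' + i)"
      "cyc ws' (s' + j) = v" "cyc ws' (Suc (s' + j)) = u" using \<open>R q j u\<close> unfolding R_def by blast
    have "cyc ws (s + i) = cyc ws' (s' + i)" for i
      by (rule rotation_walk_determined[OF G 1(1) 2(1), where j = j]) (simp_all add: 1 2)
    then have "p ! i = q ! i" if "i < n" for i using 1(2) 2(2) that by simp
    moreover have "length p = n" "length q = n" using that by (auto simp: R_def)
    ultimately show "p = q" by (intro nth_equalityI) auto
  qed
  have "?Q \<subseteq> (\<lambda>(j, u). THE p. R p j u) ` ({..<n} \<times> nbrs G v)"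
  proof
    fix p assume p: "p \<in> ?Q"
    then obtain ws s where w: "rotation_walk G ws" "\<forall>i<length p. p ! i = cyc ws (s + i)"
      by (auto simp: walk_paths_def)
    obtain j where j: "j < n" "p ! j = v" using p by (auto simp: in_set_conv_nth)
    \<comment> \<open>The successor is taken on the walk and not on \<open>p\<close>, so it exists
      even if \<open>v\<close> is the last vertex of \<open>p\<close>.\<close>
    define u where "u = cyc ws (Suc (s + j))"
    have "R p j u" unfolding R_def u_def using p w j by auto
    then have "(THE p. R p j u) = p" using uniq by blast
    moreover have "u \<in> nbrs G v" unfolding u_def using rotation_walk_adj[OF w(1), of "s + j"] w j p by auto
    ultimately show "p \<in> (\<lambda>(j, u). THE p. R p j u) ` ({..<n} \<times> nbrs G v)"
      using j by (intro image_eqI[of _ _ "(j, u)"]) auto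
  qed
  moreover have fin: "finite ({..<n} \<times> nbrs G v)" using finite_nbrs[OF G] by simp
  ultimately show "finite ?Q" by (meson finite_imageI finite_subset)
  have "card ?Q \<le> card ({..<n} \<times> nbrs G v)"
    using \<open>?Q \<subseteq> _\<close> fin by (meson surj_card_le)
  also have "\<dots> \<le> n * max_degree G" using card_nbrs_le[OF G v] by (simp add: card_cartesian_product)
  finally show "card ?Q \<le> n * max_degree G" .
qed

text \<open>The second vertex of a longer path would have two distinct neighbours.\<close>

lemma walk_paths_max_degree_1:
  assumes "plane_graph G" "max_degree G = 1" "p \<in> walk_paths G" "set p \<subseteq> verts G"
  shows "length p \<le> 2"
proof (rule ccontr)
  assume "\<not> length p \<le> 2"
  then have len: "2 < length p" by simp
  have "p ! 0 \<noteq> p ! 2" using assms(3) len by (subst nth_eq_iff_index_eq) (auto simp: walk_paths_def)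
  moreover have "{p ! 0, p ! 2} \<subseteq> nbrs G (p ! 1)"
    using walk_paths_adj[OF assms(3), of 0] walk_paths_adj[OF assms(3), of 1] len
    by (auto simp: numeral_2_eq_2)
  ultimately have "2 \<le> card (nbrs G (p ! 1))"
    using card_mono[OF finite_nbrs[OF assms(1)]] by (metis card_2_iff)
  moreover have "p ! 1 \<in> verts G" using assms(4) len by (auto simp: subset_iff)
  ultimately show False using card_nbrs_le[OF assms(1), of "p ! 1"] assms(2) by simp
qed

section \<open>Choosability\<close>

text \<open>If \<open>\<Delta> = 1\<close>, there are no facial paths with more than two vertices.\<close>

definition path_bound :: "nat \<Rightarrow> nat \<Rightarrow> nat" where
  "path_bound d m = (if m = 0 then d else if d = 1 then 0 else 2 * Suc m * d)"

lemma facial_nonrep_choosable_if: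
  assumes G: "plane_graph G" and \<beta>: "\<beta> > 0"
    and bound: "\<And>N. \<beta> + (\<Sum>m<N. path_bound (max_degree G) m / \<beta> ^ m) \<le> l"
  shows "facial_nonrep_choosable G l"
  unfolding facial_nonrep_choosable_def
proof (intro allI impI)
  fix L :: "complex \<Rightarrow> nat set"
  assume L: "\<forall>v\<in>verts G. L v \<subseteq> {1..} \<and> (finite (L v) \<longrightarrow> l \<le> card (L v))"
  \<comment> \<open>The counting works with finite lists of size exactly \<open>l\<close>, so larger
    or infinite lists are cut down.\<close>
  have "\<exists>A. A \<subseteq> L v \<and> finite A \<and> card A = l" if "v \<in> verts G" for v
    using L that by (meson infinite_arbitrarily_large obtain_subset_with_card_n)
  then obtain A where A: "\<And>v. v \<in> verts G \<Longrightarrow> A v \<subseteq> L v \<and> finite (A v) \<and> card (A v) = l"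
    by metis
  define P where "P = {p \<in> walk_paths G. set p \<subseteq> verts G}"
  \<comment> \<open>For \<open>m = 0\<close> each edge at \<open>v\<close> is listed once, starting
    at \<open>v\<close>; this gives the bound \<Delta> where counting both directions would give
    2\<Delta>.\<close>
  define Q where "Q v m = (if m = 0 then (\<lambda>u. [v, u]) ` nbrs G v
    else {p \<in> P. length p = 2 * Suc m \<and> v \<in> set p})" for v m
  interpret nonrep_counting "verts G" P Q "path_bound (max_degree G)" A l \<beta>
  proof
    show "finite (verts G)" using G by (simp add: plane_graph_def)
    show "distinct p" if "p \<in> P" for p using that by (simp add: P_def walk_paths_def)
    show "finite (Q v m)" if "v \<in> verts G" for v m
    proof (cases "m = 0")
      case False
      then show ?thesis using card_walk_paths_through(1)[OF G that, of "2 * Suc m"]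
        by (auto simp: Q_def P_def elim: rev_finite_subset)
    qed (simp add: Q_def finite_nbrs[OF G])
    show "real (card (Q v m)) \<le> path_bound (max_degree G) m" if "v \<in> verts G" for v m
    proof -
      consider "m = 0" | "m > 0" "max_degree G = 1" | "m > 0" "max_degree G \<noteq> 1" by auto
      then have "card (Q v m) \<le> path_bound (max_degree G) m"
      proof cases
        case 1
        have "card ((\<lambda>u. [v, u]) ` nbrs G v) \<le> card (nbrs G v)"
          using finite_nbrs[OF G] by (rule card_image_le)
        then show ?thesis using 1 card_nbrs_le[OF G that] by (simp add: Q_def path_bound_def)
      next
        case 2
        then have "Q v m = {}" using walk_paths_max_degree_1[OF G] by (force simp: Q_def P_def)
        then show ?thesis by simp
      next
        case 3
        have "card (Q v m) \<le> card {p \<in> walk_paths G. length p = 2 * Suc m \<and> v \<in> set p}"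
          using 3 card_walk_paths_through(1)[OF G that]
          by (intro card_mono) (auto simp: Q_def P_def)
        then show ?thesis using 3 card_walk_paths_through(2)[OF G that, of "2 * Suc m"]
          by (simp add: path_bound_def)
      qed
      then show ?thesis by simp
    qed
    show "distinct p \<and> length p = 2 * Suc m \<and> v \<in> set p" if "p \<in> Q v m" for v m p
    proof (cases "m = 0")
      case True
      then show ?thesis using that plane_graph_edge(1)[OF G] by (auto simp: Q_def nbrs_def)
    qed (use that in \<open>auto simp: Q_def P_def walk_paths_def\<close>)
    show "p \<in> Q v m \<or> rev p \<in> Q v m" if p: "p \<in> P" "v \<in> set p" "length p = 2 * Suc m" for v m p
    proof (cases "m = 0")
      case True
      then obtain x y where xy: "p = [x, y]" using p(3)
        by (auto simp: length_Suc_conv numeral_2_eq_2)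
      then show ?thesis using True p walk_paths_adj[of p G 0] by (auto simp: Q_def P_def)
    qed (use p in \<open>simp add: Q_def\<close>)
  qed (use A \<beta> bound in auto)
  obtain \<phi> where \<phi>: "\<And>v. v \<in> verts G \<Longrightarrow> \<phi> v \<in> A v"
    "\<And>p. p \<in> P \<Longrightarrow> set p \<subseteq> verts G \<Longrightarrow> \<not> repetition (map \<phi> p)"
    by (rule nonrep_colouring_exists) blast
  have "\<not> repetition (map \<phi> p)" if p: "facial_path G p" for p
  proof -
    have "p \<in> P \<or> rev p \<in> P" "set p \<subseteq> verts G"
      using facial_path_walk_paths[OF p] facial_path_verts[OF G p] by (auto simp: P_def)
    then show ?thesis using \<phi>(2)[of p] \<phi>(2)[of "rev p"] repetition_rev[of "map \<phi> p"]
      by (auto simp: rev_map)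
  qed
  then show "\<exists>\<phi>. (\<forall>v\<in>verts G. \<phi> v \<in> L v) \<and> facial_nonrepetitive G \<phi>"
    using \<phi>(1) A unfolding facial_nonrepetitive_def by (intro exI[of _ \<phi>]) blast
qed

section \<open>Numerical estimates\<close>

lemma sum_path_bound_le:
  fixes \<beta> :: real
  assumes "\<beta> > 1"
  shows "(\<Sum>m<N. path_bound d m / \<beta> ^ m) \<le> d * (2 / (1 - 1 / \<beta>)\<^sup>2 - 1)"
proof (cases N)
  case 0
  \<comment> \<open>For the empty sum the right-hand side has to be shown nonnegative.\<close>
  have "(1 - 1 / \<beta>)\<^sup>2 \<le> 1" using assms by (intro power_le_one) auto
  then have "2 / (1 - 1 / \<beta>)\<^sup>2 \<ge> 1" using assms by (subst le_divide_eq_1_pos) auto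
  then show ?thesis using 0 by simp
next
  case (Suc M)
  define x where "x = 1 / \<beta>"
  have x: "0 < x" "x < 1" using assms by (auto simp: x_def)
  \<comment> \<open>The differentiated geometric series, at \<open>x = 1 / \<beta>\<close>.\<close>
  have "(\<lambda>n. of_nat (Suc n) * x ^ n) sums (1 / (1 - x)\<^sup>2)" using x by (intro geometric_deriv_sums) simp
  then have le: "(\<Sum>m<N. real (Suc m) * x ^ m) \<le> 1 / (1 - x)\<^sup>2"
    using sum_le_suminf[of "\<lambda>n. real (Suc n) * x ^ n" "{..<N}"] x by (auto simp: sums_iff)
  \<comment> \<open>The term \<open>m = 0\<close> is \<open>d\<close> and not \<open>2 * d\<close>;
    the correction is subtracted exactly once because \<open>N > 0\<close>.\<close>
  have "(\<Sum>m<N. path_bound d m / \<beta> ^ m)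
      \<le> (\<Sum>m<N. 2 * d * (Suc m * x ^ m) - (if m = 0 then real d else 0))"
    using x(1) by (intro sum_mono) (auto simp: path_bound_def x_def power_divide algebra_simps)
  also have "\<dots> = 2 * d * (\<Sum>m<N. Suc m * x ^ m) - d"
    using Suc by (simp add: sum_subtractf flip: sum_distrib_left)
  also have "\<dots> \<le> 2 * d * (1 / (1 - x)\<^sup>2) - d" using le by (intro diff_right_mono mult_left_mono) auto
  finally show ?thesis by (simp add: x_def algebra_simps)
qed

lemma facial_nonrep_choosable_5:
  assumes "plane_graph G" "max_degree G \<ge> 1"
  shows "facial_nonrep_choosable G (5 * max_degree G)"
proof (cases "max_degree G = 1")
  case True
  \<comment> \<open>Only the term \<open>m = 0\<close> is nonzero, so \<open>\<beta> = 4\<close>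
    gives 4 + 1 = 5.\<close>
  have "(\<Sum>m<N. path_bound 1 m / 4 ^ m) \<le> (1::real)" for N
  proof -
    have "(\<Sum>m<N. path_bound 1 m / 4 ^ m) = (\<Sum>m<N. if m = 0 then 1 else 0 :: real)"
      by (intro sum.cong) (auto simp: path_bound_def)
    also have "\<dots> \<le> 1" by (simp add: sum.delta)
    finally show ?thesis .
  qed
  then show ?thesis using True assms by (intro facial_nonrep_choosable_if[where \<beta> = 4]) auto
next
  case False
  define d where "d = max_degree G"
  have d: "d \<ge> 2" using False assms by (simp add: d_def)
  \<comment> \<open>Then \<open>1 - 1 / ?\<beta>\<close> is at least 3/4, and 2/(3/4)^2 - 1 = 23/9
    is below 3, so the total is at most 2d + 3d.\<close>
  let ?\<beta> = "2 * real d"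
  have "1 / ?\<beta> \<le> 1 / 4" using d by (simp add: field_simps)
  then have "(3 / 4)\<^sup>2 \<le> (1 - 1 / ?\<beta>)\<^sup>2" by (intro power_mono) auto
  then have "2 / (1 - 1 / ?\<beta>)\<^sup>2 \<le> 2 / (3 / 4)\<^sup>2" by (intro divide_left_mono) (auto simp: power2_eq_square)
  then have le: "d * (2 / (1 - 1 / ?\<beta>)\<^sup>2 - 1) \<le> d * (3::real)" by (intro mult_left_mono) (auto simp: power2_eq_square)
  then have "?\<beta> + (\<Sum>m<N. path_bound d m / ?\<beta> ^ m) \<le> real (5 * d)" for N
  proof -
    have "(\<Sum>m<N. path_bound d m / ?\<beta> ^ m) \<le> d * (2 / (1 - 1 / ?\<beta>)\<^sup>2 - 1)"
      using d by (intro sum_path_bound_le) simp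
    then show ?thesis using le by linarith
  qed
  then show ?thesis using d assms(1) unfolding d_def
    by (intro facial_nonrep_choosable_if[where \<beta> = "2 * real (max_degree G)"]) auto
qed

lemma facial_nonrep_choosable_2:
  assumes "plane_graph G" "max_degree G \<ge> 20"
  shows "facial_nonrep_choosable G (2 * max_degree G)"
proof -
  define d where "d = max_degree G"
  have d: "d \<ge> 20" using assms by (simp add: d_def)
  \<comment> \<open>From d \<ge> 20 follows \<open>1 - 1 / ?\<beta> \<ge> 9 / 10\<close>, and
    2/(9/10)^2 - 1 = 119/81 is below 3/2, so the total is at most d/2 + 3d/2.\<close>
  let ?\<beta> = "real d / 2"
  have "1 / ?\<beta> \<le> 1 / 10" using d by (simp add: field_simps)
  then have "(9 / 10)\<^sup>2 \<le> (1 - 1 / ?\<beta>)\<^sup>2" by (intro power_mono) auto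
  then have "2 / (1 - 1 / ?\<beta>)\<^sup>2 \<le> 2 / (9 / 10)\<^sup>2" by (intro divide_left_mono) (auto simp: power2_eq_square)
  then have le: "d * (2 / (1 - 1 / ?\<beta>)\<^sup>2 - 1) \<le> d * (3 / 2)"
    by (intro mult_left_mono) (auto simp: power2_eq_square)
  then have "?\<beta> + (\<Sum>m<N. path_bound d m / ?\<beta> ^ m) \<le> real (2 * d)" for N
  proof -
    have "(\<Sum>m<N. path_bound d m / ?\<beta> ^ m) \<le> d * (2 / (1 - 1 / ?\<beta>)\<^sup>2 - 1)"
      using d by (intro sum_path_bound_le) simp
    then show ?thesis using le by linarith
  qed
  then show ?thesis using d assms(1) unfolding d_def
    by (intro facial_nonrep_choosable_if[where \<beta> = "real (max_degree G) / 2"]) auto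
qed

theorem theorem4:
  "(\<forall>G. plane_graph G \<and> max_degree G \<ge> 1 \<longrightarrow>
      facial_thue_choice_number G \<le> 5 * max_degree G) \<and>
   (\<exists>g :: nat \<Rightarrow> nat.
      (\<forall>d\<ge>1. g d \<ge> 1) \<and>
      (\<lambda>d. real (g d) / real d) \<longlonglongrightarrow> 2 \<and>
      (\<forall>G. plane_graph G \<and> max_degree G \<ge> 1 \<longrightarrow>
         facial_thue_choice_number G \<le> g (max_degree G)))"
proof (intro conjI exI)
  \<comment> \<open>Small degrees fall back on the first bound; the ratio is constantly 2 from 20
    on.\<close>
  define g :: "nat \<Rightarrow> nat" where "g d = (if d < 20 then 5 * d else 2 * d)" for d
  show 5: "\<forall>G. plane_graph G \<and> max_degree G \<ge> 1 \<longrightarrow>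
      facial_thue_choice_number G \<le> 5 * max_degree G"
    unfolding facial_thue_choice_number_def by (intro allI impI Least_le facial_nonrep_choosable_5) auto
  show "\<forall>d\<ge>1. g d \<ge> 1" by (simp add: g_def)
  have "\<forall>\<^sub>F d in sequentially. real (g d) / real d = 2"
    using eventually_ge_at_top[of 20] by eventually_elim (simp add: g_def)
  then show "(\<lambda>d. real (g d) / real d) \<longlonglongrightarrow> 2" by (rule tendsto_eventually)
  have 2: "facial_thue_choice_number G \<le> 2 * max_degree G"
    if "plane_graph G" "max_degree G \<ge> 20" for G
    using facial_nonrep_choosable_2[OF that] unfolding facial_thue_choice_number_def by (rule Least_le)
  show "\<forall>G. plane_graph G \<and> max_degree G \<ge> 1 \<longrightarrow> facial_thue_choice_number G \<le> g (max_degree G)"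
    using 5 2 by (auto simp: g_def)
qed

end
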